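(* Let $h$ be a unit cost function and let $p_0(t)>0$, $p(t)=(p_1(t),\dots,p_n(t))>0$, $t=1,\dots,T$, be fixed. For $y=(y(1),\dots,y(T))$ with $y(t)\ge0$, consider: (N) for any $\Omega_1,\Omega_2\subseteq\{1,\dots,T\}$, the componentwise inequality $\sum_{t\in\Omega_1}w(t)\ge\sum_{t\in\Omega_2}w(t)$ implies $\sum_{t\in\Omega_1}y(t)\ge\sum_{t\in\Omega_2}y(t)$; (S) there exists a non-negative absolutely continuous measure $\mu$ with $\int_{\mathbb R^n_+}\theta\bigl(p_0(t)-h(p(t)\circ x)\bigr)\mu(dx)=y(t)$ for $t=1,\dots,T$. Then condition (N) is sufficient for (S) (that is, (N) implies (S) for every such $y$) if and only if the polyhedral cone $\Gamma_h(\widehat p)$ is discretely convex.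
   Context: $\mathbb R^n_+=\{x\in\mathbb R^n: x_i\ge0\}$; $p\circ x=(p_1x_1,\dots,p_nx_n)$; $\theta(s)=1$ for $s\ge0$ and $\theta(s)=0$ for $s<0$; $p(t)>0$ means all components positive. Unit cost function: a function $h$ on $\mathbb R^n_+$, continuous and positive on $\operatorname{int}\mathbb R^n_+$, with $h(\lambda x)=\lambda h(x)$ for $\lambda>0$. Absolutely continuous means with respect to Lebesgue measure. Empty sums are zero. Put $\widehat p(t)=p(t)/p_0(t)$. $\Lambda_h(\widehat p)$ is the set of domains of the partition of $\mathbb R^n_+$ by the hypersurfaces $\{x\mid h(p(t)\circ x)=p_0(t)\}$, i.e. of the non-empty sets among $$G_S=\{x\in\operatorname{int}\mathbb R^n_+\mid h(p(t)\circ x)>p_0(t)\ \forall t\in S,\ \ h(p(t)\circ x)<p_0(t)\ \forall t\in\{1,\dots,T\}\setminus S\},\quad S\subseteq\{1,\dots,T\}.$$ The spectrum of $G\in\Lambda_h(\widehat p)$ is $Z(G)=(Z_1(G),\dots,Z_T(G))$ with $Z_t(G)=1$ if $p_0(t)>h(p(t)\circ x)$ for all $x\in G$, and $Z_t(G)=0$ if $p_0(t)<h(p(t)\circ x)$ for all $x\in G$. Put $w(t)=(w_G(t)\mid G\in\Lambda_h(\widehat p))$ with $w_G(t)=Z_t(G)$. $\Gamma_h(\widehat p)$ is the convex cone in $\mathbb R^T$ spanned by $\{Z(G)\mid G\in\Lambda_h(\widehat p)\}$. A polyhedral cone is a convex cone spanned by a finite set of points. The dual cone of $\Gamma\subseteq\mathbb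 R^T$ is $\Gamma^*=\{\nu\in\mathbb R^T\mid \nu\cdot y\ge0\ \text{for all } y\in\Gamma\}$. A polyhedral cone $\Gamma\subseteq\mathbb R^T$ is called discretely convex if all vertices of both polyhedra $\Gamma\cap[-1,1]^T$ and $\Gamma^*\cap[-1,1]^T$ have coordinates in $\{-1,0,1\}$. The paper notes the following reformulation of discrete convexity: (i) $\Gamma$ is spanned by a finite set of vectors with coordinates in $\{-1,0,1\}$, and (ii) each face of $\Gamma$ admits a non-zero normal vector with coordinates in $\{-1,0,1\}$ (normals to faces are the edges of $\Gamma^*$).
   Formalization: Discretely convex here means that the cone, and the cone of normals to each of its faces, are spanned by vectors with coordinates in {-1,0,1}; with the definition by vertices of the intersections with the cube, the "only if" part is false (counterexample with T=6, n=2). *)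

theory Defs
  imports "HOL-Analysis.Analysis"
begin

text \<open>
  The goods \<open>1..n\<close> and the periods \<open>1..T\<close> are indexed by finite types \<open>'n\<close> and \<open>'t\<close>.
  The current data are \<open>p0 :: 't \<Rightarrow> real\<close> and \<open>p :: 't \<Rightarrow> real ^ 'n\<close>.
\<close>

definition orthant :: "(real ^ 'n) set" where
  "orthant = {x. \<forall>i. 0 \<le> x $ i}"

definition cprod :: "real ^ 'n \<Rightarrow> real ^ 'n \<Rightarrow> real ^ 'n" (infixl "\<otimes>\<^sub>c" 75) where
  "p \<otimes>\<^sub>c x = (\<chi> i. p $ i * x $ i)"

definition theta :: "real \<Rightarrow> real" where
  "theta s = (if s \<ge> 0 then 1 else 0)"

text \<open>Values of \<open>h\<close> outside \<open>orthant\<close> are irrelevant; neither continuity nor positivity is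
  required on the boundary.\<close>

definition unit_cost_function :: "(real ^ 'n \<Rightarrow> real) \<Rightarrow> bool" where
  "unit_cost_function h \<longleftrightarrow>
     continuous_on (interior orthant) h \<and>
     (\<forall>x\<in>interior orthant. h x > 0) \<and>
     (\<forall>x\<in>orthant. \<forall>c>0. h (c *\<^sub>R x) = c * h x)"


subsection \<open>Domains, spectra and the cone of spectra\<close>

definition cell ::
  "(real ^ 'n \<Rightarrow> real) \<Rightarrow> ('t \<Rightarrow> real) \<Rightarrow> ('t \<Rightarrow> real ^ 'n) \<Rightarrow> 't set \<Rightarrow> (real ^ 'n) set" where
  "cell h p0 p S = {x \<in> interior orthant.
     (\<forall>t\<in>S. h (p t \<otimes>\<^sub>c x) > p0 t) \<and> (\<forall>t\<in>- S. h (p t \<otimes>\<^sub>c x) < p0 t)}"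

definition domains ::
  "(real ^ 'n \<Rightarrow> real) \<Rightarrow> ('t \<Rightarrow> real) \<Rightarrow> ('t \<Rightarrow> real ^ 'n) \<Rightarrow> (real ^ 'n) set set" where
  "domains h p0 p = {G. G \<noteq> {} \<and> (\<exists>S. G = cell h p0 p S)}"

text \<open>On a domain the sign of \<open>p0 t - h (p t \<otimes>\<^sub>c x)\<close> does not depend on \<open>x\<close>, so that the
  \<open>else\<close> branch is the case \<open>p0 t < h (p t \<otimes>\<^sub>c x)\<close> for all \<open>x\<close> in the domain.\<close>

definition spectrum ::
  "(real ^ 'n \<Rightarrow> real) \<Rightarrow> ('t::finite \<Rightarrow> real) \<Rightarrow> ('t \<Rightarrow> real ^ 'n) \<Rightarrow> (real ^ 'n) set \<Rightarrow> real ^ 't" where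
  "spectrum h p0 p G = (\<chi> t. if \<forall>x\<in>G. p0 t > h (p t \<otimes>\<^sub>c x) then 1 else 0)"

definition spectral_cone ::
  "(real ^ 'n \<Rightarrow> real) \<Rightarrow> ('t::finite \<Rightarrow> real) \<Rightarrow> ('t \<Rightarrow> real ^ 'n) \<Rightarrow> (real ^ 't) set" where
  "spectral_cone h p0 p = convex_cone hull (spectrum h p0 p ` domains h p0 p)"

definition condition_N ::
  "(real ^ 'n \<Rightarrow> real) \<Rightarrow> ('t::finite \<Rightarrow> real) \<Rightarrow> ('t \<Rightarrow> real ^ 'n) \<Rightarrow> real ^ 't \<Rightarrow> bool" where
  "condition_N h p0 p y \<longleftrightarrow>
     (\<forall>\<Omega>1 \<Omega>2 :: 't set.
        (\<forall>G\<in>domains h p0 p.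
           (\<Sum>t\<in>\<Omega>1. spectrum h p0 p G $ t) \<ge> (\<Sum>t\<in>\<Omega>2. spectrum h p0 p G $ t)) \<longrightarrow>
        (\<Sum>t\<in>\<Omega>1. y $ t) \<ge> (\<Sum>t\<in>\<Omega>2. y $ t))"

text \<open>The measure lives on the Lebesgue rather than the Borel subsets of the orthant because
  \<open>h\<close> is arbitrary on the boundary, where it need not be Borel. Absolutely continuous Borel
  measures extend uniquely to these sets.\<close>

definition condition_S ::
  "(real ^ 'n \<Rightarrow> real) \<Rightarrow> ('t::finite \<Rightarrow> real) \<Rightarrow> ('t \<Rightarrow> real ^ 'n) \<Rightarrow> real ^ 't \<Rightarrow> bool" where
  "condition_S h p0 p y \<longleftrightarrow>
     (\<exists>\<mu> :: (real ^ 'n) measure.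
        sets \<mu> = sets (lebesgue_on orthant) \<and>
        absolutely_continuous (lebesgue_on orthant) \<mu> \<and>
        (\<forall>t. has_bochner_integral \<mu> (\<lambda>x. theta (p0 t - h (p t \<otimes>\<^sub>c x))) (y $ t)))"


subsection \<open>Discrete convexity\<close>

definition polyhedral_cone :: "(real ^ 't) set \<Rightarrow> bool" where
  "polyhedral_cone K \<longleftrightarrow> (\<exists>V. finite V \<and> K = convex_cone hull V)"

definition dual_cone :: "(real ^ 't::finite) set \<Rightarrow> (real ^ 't) set" where
  "dual_cone K = {\<nu>. \<forall>y\<in>K. \<nu> \<bullet> y \<ge> 0}"

definition normal_cone :: "(real ^ 't::finite) set \<Rightarrow> (real ^ 't) set \<Rightarrow> (real ^ 't) set" where
  "normal_cone K F = {\<nu> \<in> dual_cone K. \<forall>y\<in>F. \<nu> \<bullet> y = 0}"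

definition sign_spanned :: "(real ^ 't) set \<Rightarrow> bool" where
  "sign_spanned K \<longleftrightarrow>
     (\<exists>V. finite V \<and> (\<forall>v\<in>V. \<forall>t. v $ t \<in> {-1, 0, 1}) \<and> K = convex_cone hull V)"

text \<open>
  Discrete convexity by generators and face normals: the cone is spanned by vectors with
  coordinates in \<open>{-1, 0, 1}\<close>, and so are the normals to each of its faces. If \<open>K\<close> has
  non-empty interior, the normals to a facet form a ray (an edge of the dual cone), and the
  condition on that facet says that it has a non-zero normal with coordinates in
  \<open>{-1, 0, 1}\<close>. If \<open>K\<close> has empty interior, normals to facets are not unique up to scaling,
  and the condition covers all of them, in particular the orthogonal complement of \<open>K\<close>
  (the case \<open>F = K\<close>).

  The formulation by vertices, namely that all vertices of \<open>K \<inter> [-1,1]\<^sup>T\<close> and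
  of \<open>dual_cone K \<inter> [-1,1]\<^sup>T\<close> have coordinates in \<open>{-1, 0, 1}\<close>, is strictly stronger.
  The cone in dimension 6 given by \<open>x1, ..., x6 \<ge> 0\<close>, \<open>x1 \<le> x4 + x5\<close>, \<open>x2 \<le> x4 + x6\<close>,
  \<open>x3 \<le> x5 + x6\<close> is spanned by vectors with coordinates in \<open>{0, 1}\<close> and has facet normals
  with coordinates in \<open>{-1, 0, 1}\<close>, but \<open>(1, 1, 1, 1/2, 1/2, 1/2)\<close> is a vertex of its
  intersection with the cube. It is the spectral cone of a suitable unit cost function, and
  the characterisation of sufficiency fails for it under the vertex formulation.
\<close>

definition discretely_convex :: "(real ^ 't::finite) set \<Rightarrow> bool" where
  "discretely_convex K \<longleftrightarrow>
     polyhedral_cone K \<and> sign_spanned K \<and>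
     (\<forall>F. F face_of K \<longrightarrow> sign_spanned (normal_cone K F))"

end

theory Submission
  imports Defs
begin

text \<open>
  Condition (S) says precisely that \<open>y\<close> lies in the spectral cone: the hypersurfaces are
  met at most once by every ray, hence are null sets, so that the integral in (S) at time \<open>t\<close>
  is the total mass of the domains \<open>G\<close> with \<open>Z\<^sub>t(G) = 1\<close>; conversely arbitrary masses can be
  put on the domains because they are open. Condition (N) says that \<open>y\<close> is non-negative on all
  vectors of the dual cone with coordinates in \<open>{-1, 0, 1}\<close>. By Farkas' lemma, (N) therefore
  implies (S) if and only if these vectors span the dual cone. The normals to a face form a
  face of the dual cone, and a face is spanned by the generators that it contains, so this is
  discrete convexity.
\<close>

subsection \<open>Finitely generated cones\<close>

lemma convex_cone_sum:
  assumes "convex_cone C" "\<And>i. i \<in> I \<Longrightarrow> x i \<in> C"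
  shows "sum x I \<in> C"
  using assms(2)
  by (induction I rule: infinite_finite_induct)
     (auto simp: convex_cone_contains_0 convex_cone_add assms(1))

text \<open>Explicit coefficients make it possible to say which generators occur in a vector of the
  cone.\<close>

lemma convex_cone_hull_finite:
  assumes "finite V"
  shows "convex_cone hull V = {\<Sum>v\<in>V. u v *\<^sub>R v |u. \<forall>v\<in>V. 0 \<le> u v}" (is "_ = ?C")
proof (rule hull_unique)
  show "V \<subseteq> ?C"
  proof
    fix w assume "w \<in> V"
    then have "w = (\<Sum>v\<in>V. (if v = w then 1 else 0) *\<^sub>R v)"
      using assms by (simp add: if_distrib [of "\<lambda>c. c *\<^sub>R _"] cong: if_cong)
    then show "w \<in> ?C" by fastforce
  qed
  show "convex_cone ?C"
    unfolding convex_cone_iff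
  proof (intro conjI ballI allI impI)
    show "0 \<in> ?C" by (auto intro!: exI [of _ "\<lambda>_. 0"])
  next
    fix x y assume "x \<in> ?C" "y \<in> ?C"
    then obtain a b where "x = (\<Sum>v\<in>V. a v *\<^sub>R v)" "y = (\<Sum>v\<in>V. b v *\<^sub>R v)"
      and "\<forall>v\<in>V. 0 \<le> a v" "\<forall>v\<in>V. 0 \<le> b v" by auto
    then show "x + y \<in> ?C"
      by (auto intro!: exI [of _ "\<lambda>v. a v + b v"] simp: scaleR_left_distrib sum.distrib)
  next
    fix x and c :: real assume "x \<in> ?C" "0 \<le> c"
    then obtain a where "x = (\<Sum>v\<in>V. a v *\<^sub>R v)" "\<forall>v\<in>V. 0 \<le> a v" by auto
    with \<open>0 \<le> c\<close> show "c *\<^sub>R x \<in> ?C"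
      by (auto intro!: exI [of _ "\<lambda>v. c * a v"] simp: scaleR_sum_right)
  qed
  show "?C \<subseteq> D" if "V \<subseteq> D" "convex_cone D" for D
    using that by (auto intro!: convex_cone_sum convex_cone_scaleR)
qed

section \<open>Dual cones and Farkas' lemma\<close>

lemma convex_cone_dual_cone: "convex_cone (dual_cone K)"
  by (auto simp: convex_cone_iff dual_cone_def inner_add_left)

text \<open>For fixed \<open>\<nu>\<close> the half-space
  \<open>{x. 0 \<le> \<nu> \<bullet> x}\<close> is a convex cone, so it contains the hull as soon as
  it contains \<open>V\<close>.\<close>

lemma dual_cone_convex_cone_hull: "dual_cone (convex_cone hull V) = {\<nu>. \<forall>v\<in>V. 0 \<le> \<nu> \<bullet> v}"
proof
  show "{\<nu>. \<forall>v\<in>V. 0 \<le> \<nu> \<bullet> v} \<subseteq> dual_cone (convex_cone hull V)"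
  proof
    fix \<nu> assume "\<nu> \<in> {\<nu>. \<forall>v\<in>V. 0 \<le> \<nu> \<bullet> v}"
    then have "convex_cone hull V \<subseteq> {x. 0 \<le> \<nu> \<bullet> x}"
      by (intro hull_minimal convex_cone_halfspace_ge) auto
    then show "\<nu> \<in> dual_cone (convex_cone hull V)" by (auto simp: dual_cone_def)
  qed
qed (auto simp: dual_cone_def hull_inc)

text \<open>The cone is closed because \<open>V\<close> is finite, so a hyperplane strictly
  separates it from \<open>z\<close>. Invariance under positive scaling forces the separating
  functional to be non-negative on \<open>V\<close>.\<close>

lemma Farkas:
  assumes "finite V" "z \<notin> convex_cone hull V"
  obtains \<nu> where "\<nu> \<in> dual_cone (convex_cone hull V)" "\<nu> \<bullet> z < 0"
proof -
  obtain a b where a: "a \<bullet> z < b" and b: "\<And>x. x \<in> convex_cone hull V \<Longrightarrow> b < a \<bullet> x"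
    using separating_hyperplane_closed_point
      [OF convex_convex_cone_hull closed_convex_cone_hull [OF assms(1)] assms(2)] by blast
  have "b < 0" using b [OF convex_cone_hull_contains_0] by simp
  have "0 \<le> a \<bullet> v" if "v \<in> V" for v
  proof (rule ccontr)
    assume "\<not> 0 \<le> a \<bullet> v"
    then have neg: "a \<bullet> v < 0" by simp
    \<comment> \<open>This positive multiple of \<open>v\<close> lies on the hyperplane
      \<open>a \<bullet> x = b\<close>, which the cone does not meet.\<close>
    then have "(b / (a \<bullet> v)) *\<^sub>R v \<in> convex_cone hull V"
      using \<open>b < 0\<close> that by (intro convex_cone_hull_mul hull_inc) (auto simp: divide_simps)
    from b [OF this] neg show False by simp
  qed
  with a \<open>b < 0\<close> show thesis
    by (intro that [of a]) (auto simp: dual_cone_convex_cone_hull)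
qed

section \<open>Cones spanned by sign vectors\<close>

text \<open>The empty set is a face, so this identity recovers the whole dual cone from the
  condition on faces.\<close>

lemma normal_cone_empty: "normal_cone K {} = dual_cone K"
  by (simp add: normal_cone_def)

lemma finite_sign_vectors: "finite {v :: real ^ 't::finite. \<forall>t. v $ t \<in> {-1, 0, 1}}"
proof -
  have "{v :: real ^ 't. \<forall>t. v $ t \<in> {-1, 0, 1}} \<subseteq> vec_lambda ` (UNIV \<rightarrow>\<^sub>E {-1, 0, 1})"
  proof
    fix v :: "real ^ 't" assume "v \<in> {v. \<forall>t. v $ t \<in> {-1, 0, 1}}"
    then have "v = vec_lambda (vec_nth v)" "vec_nth v \<in> UNIV \<rightarrow>\<^sub>E {-1, 0, 1}" by auto
    then show "v \<in> vec_lambda ` (UNIV \<rightarrow>\<^sub>E {-1, 0, 1})" by blast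
  qed
  then show ?thesis by (rule finite_subset) (intro finite_imageI finite_PiE, auto)
qed

text \<open>In a non-negative combination that vanishes on \<open>F\<close>, a generator of the dual
  cone that is positive somewhere on \<open>F\<close> must have coefficient zero. Hence the
  generators normal to \<open>F\<close> suffice.\<close>

lemma sign_spanned_normal_cone:
  assumes "sign_spanned (dual_cone K)" "F \<subseteq> K"
  shows "sign_spanned (normal_cone K F)"
proof -
  obtain V where V: "finite V" "\<forall>v\<in>V. \<forall>t. v $ t \<in> {-1, 0, 1}" "dual_cone K = convex_cone hull V"
    using assms(1) by (auto simp: sign_spanned_def)
  have V_dual: "v \<in> dual_cone K" if "v \<in> V" for v
    using that by (simp add: V(3) hull_inc)
  define W where "W = V \<inter> normal_cone K F"
  have W: "finite W" using V(1) by (simp add: W_def)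
  have "normal_cone K F = convex_cone hull W"
  proof
    have "convex_cone (normal_cone K F)"
      using convex_cone_dual_cone [of K]
      by (auto simp: convex_cone_iff normal_cone_def inner_add_left)
    then show "convex_cone hull W \<subseteq> normal_cone K F"
      by (intro hull_minimal) (auto simp: W_def)
    show "normal_cone K F \<subseteq> convex_cone hull W"
    proof
      fix \<nu> assume \<nu>: "\<nu> \<in> normal_cone K F"
      then have "\<nu> \<in> convex_cone hull V" by (simp add: normal_cone_def flip: V(3))
      then obtain u where u: "\<nu> = (\<Sum>v\<in>V. u v *\<^sub>R v)" "\<And>v. v \<in> V \<Longrightarrow> 0 \<le> u v"
        by (auto simp: convex_cone_hull_finite [OF V(1)])
      have "u v = 0" if v: "v \<in> V - W" for v
      proof -
        obtain y where y: "y \<in> F" "v \<bullet> y \<noteq> 0"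
          using v V_dual by (auto simp: W_def normal_cone_def)
        \<comment> \<open>All terms of this sum are non-negative, so each of them vanishes.\<close>
        have "0 = (\<Sum>v\<in>V. u v * (v \<bullet> y))"
          using \<nu> y(1) by (simp add: normal_cone_def u(1) inner_sum_left)
        moreover have "0 \<le> u w * (w \<bullet> y)" if "w \<in> V" for w
          using that u(2) V_dual y(1) assms(2) by (auto simp: dual_cone_def)
        ultimately have "u v * (v \<bullet> y) = 0"
          using v V(1) sum_nonneg_eq_0_iff [of V "\<lambda>v. u v * (v \<bullet> y)"] by auto
        with y(2) show ?thesis by simp
      qed
      then have "\<nu> = (\<Sum>v\<in>W. u v *\<^sub>R v)"
        unfolding u(1) using V(1) by (intro sum.mono_neutral_right) (auto simp: W_def)
      with u(2) show "\<nu> \<in> convex_cone hull W"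
        unfolding convex_cone_hull_finite [OF W] by (auto simp: W_def)
    qed
  qed
  moreover have "\<forall>v\<in>W. \<forall>t. v $ t \<in> {-1, 0, 1}" using V(2) by (simp add: W_def)
  ultimately show ?thesis using W unfolding sign_spanned_def by blast
qed

text \<open>Bipolarity: the sign vectors of the dual cone span it exactly when they already cut out
  \<open>K\<close>. Each direction is Farkas' lemma, applied once to \<open>K\<close> and once to
  the hull of these sign vectors.\<close>

lemma sign_spanned_dual_cone_iff:
  assumes "finite V" "K = convex_cone hull V"
  shows "sign_spanned (dual_cone K) \<longleftrightarrow>
    (\<forall>y. (\<forall>\<nu>\<in>dual_cone K. (\<forall>t. \<nu> $ t \<in> {-1, 0, 1}) \<longrightarrow> 0 \<le> \<nu> \<bullet> y) \<longrightarrow> y \<in> K)"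
    (is "?L \<longleftrightarrow> ?R")
proof
  assume ?L
  then obtain W where W: "finite W" "\<forall>v\<in>W. \<forall>t. v $ t \<in> {-1, 0, 1}"
      "dual_cone K = convex_cone hull W"
    by (auto simp: sign_spanned_def)
  show ?R
  proof (intro allI impI, rule ccontr)
    fix y
    assume *: "\<forall>\<nu>\<in>dual_cone K. (\<forall>t. \<nu> $ t \<in> {-1, 0, 1}) \<longrightarrow> 0 \<le> \<nu> \<bullet> y" and "y \<notin> K"
    then obtain \<nu> where \<nu>: "\<nu> \<in> dual_cone K" "\<nu> \<bullet> y < 0"
      using Farkas assms by blast
    have "w \<bullet> y \<ge> 0" if "w \<in> W" for w
      using * W that by (simp add: hull_inc)
    then have "y \<in> dual_cone (convex_cone hull W)"
      by (simp add: dual_cone_convex_cone_hull inner_commute)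
    with \<nu> W(3) show False
      by (force simp: dual_cone_def inner_commute)
  qed
next
  assume R: ?R
  \<comment> \<open>All sign vectors of the dual cone, the largest candidate for a generating set of
    this kind.\<close>
  define W where "W = dual_cone K \<inter> {v. \<forall>t. v $ t \<in> {-1, 0, 1}}"
  have W: "finite W" unfolding W_def using finite_sign_vectors by (rule finite_Int [OF disjI2])
  have "dual_cone K = convex_cone hull W"
  proof
    show "convex_cone hull W \<subseteq> dual_cone K"
      by (intro hull_minimal convex_cone_dual_cone) (simp add: W_def)
    show "dual_cone K \<subseteq> convex_cone hull W"
    proof (rule ccontr)
      assume "\<not> dual_cone K \<subseteq> convex_cone hull W"
      then obtain \<nu> where \<nu>: "\<nu> \<in> dual_cone K" "\<nu> \<notin> convex_cone hull W" by auto
      \<comment> \<open>The roles are exchanged: the separating vector \<open>y\<close> is now a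
        point that passes every test by a sign vector.\<close>
      obtain y where y: "y \<in> dual_cone (convex_cone hull W)" "y \<bullet> \<nu> < 0"
        using Farkas [OF W \<nu>(2)] .
      then have "0 \<le> w \<bullet> y" if "w \<in> W" for w
        using that by (simp add: dual_cone_convex_cone_hull inner_commute)
      then have "y \<in> K" using R by (auto simp: W_def)
      with \<nu>(1) y(2) show False by (force simp: dual_cone_def inner_commute)
    qed
  qed
  moreover have "\<forall>v\<in>W. \<forall>t. v $ t \<in> {-1, 0, 1}" by (simp add: W_def)
  ultimately show ?L using W unfolding sign_spanned_def by blast
qed

subsection \<open>The domains\<close>

lemma interior_orthant: "interior orthant = {x :: real ^ 'n::finite. \<forall>i. 0 < x $ i}"
proof -
  have "interior orthant \<subseteq> interior {x :: real ^ 'n. x $ i \<ge> 0}" for i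
    by (intro interior_mono) (auto simp: orthant_def)
  then have "interior orthant \<subseteq> {x :: real ^ 'n. \<forall>i. 0 < x $ i}" by auto
  moreover have "{x :: real ^ 'n. \<forall>i. 0 < x $ i} = (\<Inter>i. {x. 0 < x $ i})" by auto
  then have "open {x :: real ^ 'n. \<forall>i. 0 < x $ i}"
    by (simp add: open_INT open_Collect_less continuous_on_component continuous_on_id)
  then have "{x :: real ^ 'n. \<forall>i. 0 < x $ i} \<subseteq> interior orthant"
    by (rule interior_maximal [rotated]) (auto simp: orthant_def less_imp_le)
  ultimately show ?thesis by blast
qed

lemma closed_orthant: "closed (orthant :: (real ^ 'n::finite) set)"
  unfolding orthant_def by (intro closed_Collect_all closed_Collect_le continuous_intros)

lemma orthant_lebesgue [measurable]: "(orthant :: (real ^ 'n::finite) set) \<in> sets lebesgue"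
  by (simp add: closed_orthant borel_closed)

text \<open>Continuity of \<open>h\<close> is assumed only in the interior, so the boundary is
  discarded as a null set. It is one because the orthant is convex.\<close>

lemma negligible_orthant_boundary:
  "negligible (orthant - interior orthant :: (real ^ 'n::finite) set)"
proof (rule negligible_subset)
  have "convex (orthant :: (real ^ 'n) set)"
    by (auto simp: convex_def orthant_def)
  then show "negligible (frontier (orthant :: (real ^ 'n) set))"
    by (rule negligible_convex_frontier)
qed (use closure_subset in \<open>auto simp: frontier_def\<close>)

lemma finite_domains: "finite (domains h p0 (p :: 't::finite \<Rightarrow> real ^ 'n))"
proof (rule finite_subset)
  show "domains h p0 p \<subseteq> range (cell h p0 p)" by (auto simp: domains_def)
qed simp

lemma domain_eqI:
  assumes "G \<in> domains h p0 p" "G' \<in> domains h p0 p" "x \<in> G" "x \<in> G'"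
  shows "G = G'"
proof -
  obtain S S' where S: "G = cell h p0 p S" "G' = cell h p0 p S'"
    using assms(1,2) unfolding domains_def by blast
  \<comment> \<open>The index set of a cell can be read off from any of its points.\<close>
  have "R = {t. p0 t < h (p t \<otimes>\<^sub>c x)}" if "x \<in> cell h p0 p R" for R
    using that by (force simp: cell_def)
  then have "S = S'" using assms(3,4) unfolding S by metis
  with S show ?thesis by simp
qed

lemma spectrum_eq_theta:
  assumes "G \<in> domains h p0 p" "x \<in> G"
  shows "spectrum h p0 p G $ t = theta (p0 t - h (p t \<otimes>\<^sub>c x))"
proof -
  obtain S where S: "G = cell h p0 p S" using assms(1) by (auto simp: domains_def)
  \<comment> \<open>\<open>spectrum\<close> tests a strict inequality and \<open>theta\<close> a
    weak one; on a cell equality is excluded and \<open>S\<close> decides both.\<close>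
  have "h (p t \<otimes>\<^sub>c z) < p0 t \<longleftrightarrow> t \<notin> S" "h (p t \<otimes>\<^sub>c z) \<le> p0 t \<longleftrightarrow> t \<notin> S" if "z \<in> G" for z
    using that unfolding S cell_def by (cases "t \<in> S"; force)+
  then have "(\<forall>z\<in>G. h (p t \<otimes>\<^sub>c z) < p0 t) \<longleftrightarrow> h (p t \<otimes>\<^sub>c x) \<le> p0 t"
    using assms(2) by blast
  then show ?thesis by (simp add: spectrum_def theta_def)
qed

lemma spectrum_01: "spectrum h p0 p G $ t \<in> {0, 1}"
  by (simp add: spectrum_def)

text \<open>A pair of sets of periods corresponds to the difference of their indicator vectors. Its
  premise in (N) says that this sign vector is non-negative on all spectra, that is, lies in the
  dual cone.\<close>

lemma condition_N_iff:
  fixes y :: "real ^ 't::finite"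
  shows "condition_N h p0 p y \<longleftrightarrow>
    (\<forall>\<nu>\<in>dual_cone (spectral_cone h p0 p). (\<forall>t. \<nu> $ t \<in> {-1, 0, 1}) \<longrightarrow> 0 \<le> \<nu> \<bullet> y)"
proof -
  define d :: "'t set \<Rightarrow> 't set \<Rightarrow> real ^ 't"
    where "d A B = (\<chi> t. of_bool (t \<in> A) - of_bool (t \<in> B))" for A B
  have d_inner: "d A B \<bullet> z = (\<Sum>t\<in>A. z $ t) - (\<Sum>t\<in>B. z $ t)" for A B and z :: "real ^ 't"
    by (simp add: d_def inner_vec_def left_diff_distrib sum_subtractf
        flip: sum.inter_filter [of UNIV] if_distrib)
  have d_sign: "d A B $ t \<in> {-1, 0, 1}" for A B t by (simp add: d_def)
  \<comment> \<open>Every sign vector arises from a pair, namely from the places of its entries 1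
    and -1.\<close>
  have sign_d: "\<nu> = d {t. \<nu> $ t = 1} {t. \<nu> $ t = -1}" if "\<forall>t. \<nu> $ t \<in> {-1, 0, 1}" for \<nu>
    using that by (auto simp: d_def vec_eq_iff)
  have "condition_N h p0 p y \<longleftrightarrow>
    (\<forall>A B. d A B \<in> dual_cone (spectral_cone h p0 p) \<longrightarrow> 0 \<le> d A B \<bullet> y)"
    by (simp add: condition_N_def spectral_cone_def dual_cone_convex_cone_hull d_inner)
  also have "\<dots> \<longleftrightarrow>
    (\<forall>\<nu>\<in>dual_cone (spectral_cone h p0 p). (\<forall>t. \<nu> $ t \<in> {-1, 0, 1}) \<longrightarrow> 0 \<le> \<nu> \<bullet> y)"
    using d_sign sign_d by metis
  finally show ?thesis .
qed

text \<open>Spectra are non-negative, so (N) applies with \<open>{t}\<close> on the larger side and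
  the empty set on the smaller.\<close>

lemma condition_N_nonneg:
  assumes "condition_N h p0 p y"
  shows "0 \<le> y $ t"
proof -
  have "0 \<le> spectrum h p0 p G $ t" for G using spectrum_01 [of h p0 p G t] by auto
  then show ?thesis
    using assms [unfolded condition_N_def, rule_format, of "{}" "{t}"] by simp
qed

section \<open>Openness of the domains and negligibility of their complement\<close>

locale expenditure_data =
  fixes h :: "real ^ 'n::finite \<Rightarrow> real"
    and p0 :: "'t::finite \<Rightarrow> real"
    and p :: "'t \<Rightarrow> real ^ 'n"
  assumes cost: "unit_cost_function h"
    and p0_pos: "\<And>t. p0 t > 0"
    and p_pos: "\<And>t i. p t $ i > 0"
begin

lemma cprod_interior: "x \<in> interior orthant \<Longrightarrow> p t \<otimes>\<^sub>c x \<in> interior orthant"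
  by (simp add: interior_orthant cprod_def p_pos)

lemma continuous_cost: "continuous_on (interior orthant) (\<lambda>x. h (p t \<otimes>\<^sub>c x))"
proof (rule continuous_on_compose2 [of "interior orthant" h])
  show "continuous_on (interior orthant) h" using cost by (simp add: unit_cost_function_def)
  show "continuous_on (interior orthant) (\<lambda>x. p t \<otimes>\<^sub>c x)"
    unfolding cprod_def by (intro continuous_intros)
qed (auto intro: cprod_interior)

text \<open>There are finitely many periods, so finitely many open conditions define a cell.
  Openness is what lets a domain carry absolutely continuous mass.\<close>

lemma open_cell: "open (cell h p0 p S)"
proof -
  have "cell h p0 p S = interior orthant \<inter>
      (\<Inter>t\<in>S. interior orthant \<inter> (\<lambda>x. h (p t \<otimes>\<^sub>c x)) -` {p0 t<..}) \<inter>
      (\<Inter>t\<in>-S. interior orthant \<inter> (\<lambda>x. h (p t \<otimes>\<^sub>c x)) -` {..<p0 t})"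
    by (auto simp: cell_def)
  also have "open \<dots>"
    by (intro open_Int open_INT ballI continuous_open_preimage continuous_cost open_interior) auto
  finally show ?thesis .
qed

lemma domain_open: "G \<in> domains h p0 p \<Longrightarrow> open G"
  by (auto simp: domains_def open_cell)

lemma domain_subset: "G \<in> domains h p0 p \<Longrightarrow> G \<subseteq> orthant"
  using interior_subset by (auto simp: domains_def cell_def)

text \<open>By homogeneity a ray from the origin meets the hypersurface at most once, and closed
  sets with this property are null.\<close>

lemma negligible_hypersurface:
  "negligible {x \<in> interior orthant. h (p t \<otimes>\<^sub>c x) = p0 t}"
proof -
  \<comment> \<open>Exhausts the interior by closed sets, since the hypersurface itself need not be
    closed in the whole space.\<close>
  define C :: "nat \<Rightarrow> (real ^ 'n) set" where "C k = {x. \<forall>i. inverse (Suc k) \<le> x $ i}" for k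
  define A where "A k = {x \<in> C k. h (p t \<otimes>\<^sub>c x) = p0 t}" for k
  have C_int: "C k \<subseteq> interior orthant" for k
  proof
    fix x assume "x \<in> C k"
    moreover have "0 < inverse (real (Suc k))" by simp
    ultimately show "x \<in> interior orthant"
      unfolding C_def interior_orthant by (blast intro: less_le_trans)
  qed
  have "negligible (A k)" for k
  proof (rule starlike_negligible [where a = 0])
    have "closed (C k)"
      unfolding C_def by (intro closed_Collect_all closed_Collect_le continuous_intros)
    then show "closed (A k)"
      unfolding A_def
      by (intro continuous_closed_preimage_constant continuous_on_subset [OF continuous_cost C_int])
    fix c x assume *: "0 + c *\<^sub>R x \<in> A k" "0 \<le> c" "0 + x \<in> A k"
    then have "c *\<^sub>R x \<in> interior orthant" "x \<in> interior orthant"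
      using C_int by (auto simp: A_def)
    then have "c \<noteq> 0" by (auto simp: interior_orthant)
    with \<open>0 \<le> c\<close> have "0 < c" by simp
    have "p t \<otimes>\<^sub>c x \<in> orthant"
      using cprod_interior [OF \<open>x \<in> interior orthant\<close>] interior_subset by auto
    then have "h (c *\<^sub>R (p t \<otimes>\<^sub>c x)) = c * h (p t \<otimes>\<^sub>c x)"
      using cost \<open>0 < c\<close> by (simp add: unit_cost_function_def)
    moreover have "c *\<^sub>R (p t \<otimes>\<^sub>c x) = p t \<otimes>\<^sub>c (c *\<^sub>R x)"
      by (simp add: cprod_def vec_eq_iff)
    \<comment> \<open>Both \<open>x\<close> and \<open>c *\<^sub>R x\<close> lie on the
      hypersurface, where the cost is \<open>p0 t\<close>.\<close>
    ultimately have "p0 t = c * p0 t" using * by (simp add: A_def)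
    then show "c = 1" using p0_pos [of t] by simp
  qed
  then have "negligible (\<Union>k. A k)" by (intro negligible_countable_Union) auto
  moreover have "{x \<in> interior orthant. h (p t \<otimes>\<^sub>c x) = p0 t} \<subseteq> (\<Union>k. A k)"
  proof
    fix x assume x: "x \<in> {x \<in> interior orthant. h (p t \<otimes>\<^sub>c x) = p0 t}"
    have "0 < Min (range (vec_nth x))"
      using x by (subst Min_gr_iff) (auto simp: interior_orthant)
    then obtain k where "inverse (Suc k) < Min (range (vec_nth x))"
      using reals_Archimedean by blast
    then have "x \<in> A k"
      using x by (auto simp: A_def C_def intro: less_imp_le)
    then show "x \<in> (\<Union>k. A k)" by blast
  qed
  ultimately show ?thesis by (rule negligible_subset)
qed

text \<open>An interior point on no hypersurface compares strictly in every period, and these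
  comparisons name the cell containing it.\<close>

lemma negligible_outside_domains: "negligible (orthant - \<Union>(domains h p0 p))"
proof (rule negligible_subset)
  show "negligible ((orthant - interior orthant) \<union>
      (\<Union>t. {x \<in> interior orthant. h (p t \<otimes>\<^sub>c x) = p0 t}))"
    by (intro negligible_Un negligible_orthant_boundary negligible_Union)
       (auto intro: negligible_hypersurface)
  show "orthant - \<Union>(domains h p0 p) \<subseteq> (orthant - interior orthant) \<union>
      (\<Union>t. {x \<in> interior orthant. h (p t \<otimes>\<^sub>c x) = p0 t})"
  proof
    fix x assume x: "x \<in> orthant - \<Union>(domains h p0 p)"
    show "x \<in> (orthant - interior orthant) \<union>
      (\<Union>t. {x \<in> interior orthant. h (p t \<otimes>\<^sub>c x) = p0 t})"
    proof (rule ccontr)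
      assume "\<not> ?thesis"
      then have "x \<in> interior orthant" and "\<And>t. h (p t \<otimes>\<^sub>c x) \<noteq> p0 t" using x by auto
      then have "x \<in> cell h p0 p {t. \<not> h (p t \<otimes>\<^sub>c x) < p0 t}"
        by (auto simp: cell_def not_less less_le)
      then have "x \<in> \<Union>(domains h p0 p)" unfolding domains_def by blast
      with x show False by blast
    qed
  qed
qed

section \<open>Condition (S) as membership in the spectral cone\<close>

abbreviation Z where "Z \<equiv> spectrum h p0 p"

text \<open>Only the domain containing \<open>x\<close> contributes, by disjointness.\<close>

lemma theta_eq_sum:
  assumes "x \<in> \<Union>(domains h p0 p)"
  shows "theta (p0 t - h (p t \<otimes>\<^sub>c x)) = (\<Sum>G\<in>domains h p0 p. Z G $ t * indicator G x)"
proof -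
  obtain G where G: "G \<in> domains h p0 p" "x \<in> G" using assms by auto
  have "(\<Sum>H\<in>domains h p0 p. Z H $ t * indicator H x)
      = (\<Sum>H\<in>domains h p0 p. if H = G then Z G $ t else 0)"
    using G domain_eqI by (intro sum.cong) (fastforce simp: indicator_def)+
  with G show ?thesis by (simp add: finite_domains spectrum_eq_theta)
qed

lemma AE_theta_eq_sum:
  "AE x in lebesgue_on orthant.
    theta (p0 t - h (p t \<otimes>\<^sub>c x)) = (\<Sum>G\<in>domains h p0 p. Z G $ t * indicator G x)"
proof (rule AE_I')
  show "orthant - \<Union>(domains h p0 p) \<in> null_sets (lebesgue_on orthant)"
    using negligible_outside_domains
    unfolding negligible_iff_null_sets null_sets_restrict_space [OF orthant_lebesgue] by blast
  show "{x \<in> space (lebesgue_on orthant). theta (p0 t - h (p t \<otimes>\<^sub>c x))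
      \<noteq> (\<Sum>G\<in>domains h p0 p. Z G $ t * indicator G x)} \<subseteq> orthant - \<Union>(domains h p0 p)"
    unfolding space_lebesgue_on using theta_eq_sum by blast
qed

lemma domain_lebesgue_on: "G \<in> domains h p0 p \<Longrightarrow> G \<in> sets (lebesgue_on orthant)"
  using domain_open domain_subset by (simp add: sets_restrict_space_iff borel_open)

text \<open>The values of \<open>h\<close> on the boundary do not matter because Lebesgue measure is complete.\<close>

lemma theta_measurable:
  "(\<lambda>x. theta (p0 t - h (p t \<otimes>\<^sub>c x))) \<in> borel_measurable (lebesgue_on orthant)"
proof -
  \<comment> \<open>Extension by zero transfers the question to the whole space, where a function
    equal almost everywhere to a measurable one is measurable.\<close>
  define f where "f x = (if x \<in> orthant then theta (p0 t - h (p t \<otimes>\<^sub>c x)) else 0)" for x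
  have "(\<lambda>x. \<Sum>G\<in>domains h p0 p. Z G $ t * indicator G x) \<in> borel_measurable lebesgue"
    using domain_open by (intro borel_measurable_sum borel_measurable_times borel_measurable_const
        borel_measurable_indicator) (simp add: borel_open)
  moreover have "AE x in lebesgue. (\<Sum>G\<in>domains h p0 p. Z G $ t * indicator G x) = f x"
  proof (rule AE_I')
    show "orthant - \<Union>(domains h p0 p) \<in> null_sets lebesgue"
      using negligible_outside_domains unfolding negligible_iff_null_sets .
    have "(\<Sum>G\<in>domains h p0 p. Z G $ t * indicator G x) = f x" if "x \<notin> orthant" for x
    proof -
      have "x \<notin> G" if "G \<in> domains h p0 p" for G
        using domain_subset [OF that] \<open>x \<notin> orthant\<close> by blast
      then show ?thesis using that by (simp add: f_def)
    qed
    moreover have "(\<Sum>G\<in>domains h p0 p. Z G $ t * indicator G x) = f x"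
      if "x \<in> orthant" "x \<in> \<Union>(domains h p0 p)" for x
      unfolding f_def theta_eq_sum [OF that(2)] using that(1) by simp
    ultimately show "{x \<in> space lebesgue. (\<Sum>G\<in>domains h p0 p. Z G $ t * indicator G x) \<noteq> f x}
        \<subseteq> orthant - \<Union>(domains h p0 p)"
      by blast
  qed
  ultimately have "f \<in> borel_measurable lebesgue" by (rule borel_measurable_AE)
  then show ?thesis
    unfolding f_def [abs_def] borel_measurable_if [OF orthant_lebesgue] .
qed

text \<open>Integrating the decomposition of \<open>theta\<close> over the domains exhibits
  \<open>y\<close> as a combination of spectra whose coefficients are the masses of the
  domains.\<close>

lemma condition_S_imp_spectral_cone:
  assumes "condition_S h p0 p y"
  shows "y \<in> spectral_cone h p0 p"
proof -
  obtain \<mu> where sets: "sets \<mu> = sets (lebesgue_on (orthant :: (real ^ 'n) set))"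
    and ac: "absolutely_continuous (lebesgue_on orthant) \<mu>"
    and int: "\<And>t. has_bochner_integral \<mu> (\<lambda>x. theta (p0 t - h (p t \<otimes>\<^sub>c x))) (y $ t)"
    using assms by (auto simp: condition_S_def)
  have G_sets [measurable]: "G \<in> sets \<mu>" if "G \<in> domains h p0 p" for G
    using that by (simp add: sets domain_lebesgue_on)
  have "has_bochner_integral \<mu> (\<lambda>x. Z G $ t * indicator G x) (Z G $ t * measure \<mu> G)"
    if G: "G \<in> domains h p0 p" for G t
  proof (cases "Z G $ t = 0")
    case True  \<comment> \<open>\<open>G\<close> may have infinite mass, where \<open>measure \<mu> G = 0\<close>\<close>
    then show ?thesis by (simp add: has_bochner_integral_zero)
  next
    case False
    then have Z1: "Z G $ t = 1" using spectrum_01 [of h p0 p G t] by auto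
    \<comment> \<open>Where the spectrum is 1, the integrable function \<open>theta\<close>
      dominates the indicator, so \<open>G\<close> has finite mass.\<close>
    have "integrable \<mu> (indicator G :: _ \<Rightarrow> real)"
    proof (rule Bochner_Integration.integrable_bound)
      show "integrable \<mu> (\<lambda>x. theta (p0 t - h (p t \<otimes>\<^sub>c x)))"
        using int by (rule integrable.intros)
      show "AE x in \<mu>. norm (indicat_real G x) \<le> norm (theta (p0 t - h (p t \<otimes>\<^sub>c x)))"
        using Z1 spectrum_eq_theta [OF G, of _ t] by (intro AE_I2) (auto simp: indicator_def)
    qed (use G in simp)
    then have "emeasure \<mu> G < \<infinity>"
      using G sets.sets_into_space [OF G_sets [OF G]] by (simp add: integrable_indicator_iff Int_absorb2)
    then show ?thesis
      using has_bochner_integral_real_indicator [OF G_sets [OF G]] by (simp add: Z1)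
  qed
  then have sum: "has_bochner_integral \<mu> (\<lambda>x. \<Sum>G\<in>domains h p0 p. Z G $ t * indicator G x)
      (\<Sum>G\<in>domains h p0 p. Z G $ t * measure \<mu> G)" for t
    by (rule has_bochner_integral_sum)
  have "y $ t = (\<Sum>G\<in>domains h p0 p. Z G $ t * measure \<mu> G)" for t
  proof (rule has_bochner_integral_eq [OF _ sum])
    have "AE x in \<mu>. theta (p0 t - h (p t \<otimes>\<^sub>c x))
        = (\<Sum>G\<in>domains h p0 p. Z G $ t * indicator G x)"
      by (rule absolutely_continuous_AE [OF sets ac AE_theta_eq_sum])
    from has_bochner_integral_cong_AE [OF borel_measurable_has_bochner_integral [OF int]
        borel_measurable_has_bochner_integral [OF sum] this]
    show "has_bochner_integral \<mu> (\<lambda>x. \<Sum>G\<in>domains h p0 p. Z G $ t * indicator G x) (y $ t)"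
      using int by (rule iffD1)
  qed
  then have "y = (\<Sum>G\<in>domains h p0 p. measure \<mu> G *\<^sub>R Z G)"
    by (simp add: vec_eq_iff mult.commute)
  also have "\<dots> \<in> spectral_cone h p0 p"
    unfolding spectral_cone_def
    by (intro convex_cone_sum convex_cone_convex_cone_hull convex_cone_hull_mul hull_inc) auto
  finally show ?thesis .
qed

text \<open>The coefficient of each spectrum is spread uniformly over a ball inside a domain with
  that spectrum.\<close>

lemma spectral_cone_imp_condition_S:
  assumes "y \<in> spectral_cone h p0 p"
  shows "condition_S h p0 p y"
proof -
  let ?V = "Z ` domains h p0 p"
  obtain u where u: "y = (\<Sum>v\<in>?V. u v *\<^sub>R v)" "\<And>v. v \<in> ?V \<Longrightarrow> 0 \<le> u v"
    using assms by (auto simp: spectral_cone_def convex_cone_hull_finite finite_domains)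
  \<comment> \<open>A ball replaces the domain, which may have infinite Lebesgue measure.\<close>
  have "\<exists>B. B \<subseteq> orthant \<and> B \<in> lmeasurable \<and> 0 < measure lebesgue B \<and>
      (\<forall>x\<in>B. \<forall>t. theta (p0 t - h (p t \<otimes>\<^sub>c x)) = v $ t)"
    if v: "v \<in> ?V" for v
  proof -
    obtain G where G: "v = Z G" "G \<in> domains h p0 p" using v by auto
    obtain x where "x \<in> G" using G(2) by (auto simp: domains_def)
    then obtain e where e: "0 < e" "ball x e \<subseteq> G"
      using domain_open [OF G(2)] openE by blast
    have "0 < measure lebesgue (ball x e)"
      using e(1) content_ball_pos [of e x] by simp
    moreover have "ball x e \<subseteq> orthant" using e(2) domain_subset [OF G(2)] by blast
    moreover have "theta (p0 t - h (p t \<otimes>\<^sub>c z)) = v $ t" if "z \<in> ball x e" for z t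
      using spectrum_eq_theta [OF G(2)] e(2) G(1) that by (metis subsetD)
    ultimately show ?thesis using lmeasurable_ball by blast
  qed
  then have "\<forall>v\<in>?V. \<exists>B. B \<subseteq> orthant \<and> B \<in> lmeasurable \<and> 0 < measure lebesgue B \<and>
      (\<forall>x\<in>B. \<forall>t. theta (p0 t - h (p t \<otimes>\<^sub>c x)) = v $ t)"
    by blast
  from bchoice [OF this] obtain B where "\<forall>v\<in>?V. B v \<subseteq> orthant \<and> B v \<in> lmeasurable \<and>
      0 < measure lebesgue (B v) \<and> (\<forall>x\<in>B v. \<forall>t. theta (p0 t - h (p t \<otimes>\<^sub>c x)) = v $ t)" ..
  then have B: "B v \<subseteq> orthant" "B v \<in> lmeasurable" "0 < measure lebesgue (B v)"
    "\<And>x t. x \<in> B v \<Longrightarrow> theta (p0 t - h (p t \<otimes>\<^sub>c x)) = v $ t" if "v \<in> ?V" for v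
    using that by (auto dest: bspec)
  \<comment> \<open>The density that gives each \<open>B v\<close> a contribution of total mass
    \<open>u v\<close>.\<close>
  define g where "g x = (\<Sum>v\<in>?V. u v / measure lebesgue (B v) * indicator (B v) x)" for x
  have B_sets [measurable]: "B v \<in> sets (lebesgue_on orthant)" if "v \<in> ?V" for v
    using B(1,2) [OF that] by (simp add: sets_restrict_space_iff fmeasurableD)
  have g_nonneg: "0 \<le> g x" for x
    unfolding g_def using u(2) by (intro sum_nonneg) (auto intro!: mult_nonneg_nonneg divide_nonneg_nonneg)
  have g_meas [measurable]: "g \<in> borel_measurable (lebesgue_on orthant)"
    unfolding g_def by (intro borel_measurable_sum borel_measurable_times borel_measurable_const
        borel_measurable_indicator B_sets)
  define \<mu> where "\<mu> = density (lebesgue_on orthant) g"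
  have "has_bochner_integral \<mu> (\<lambda>x. theta (p0 t - h (p t \<otimes>\<^sub>c x))) (y $ t)" for t
    unfolding \<mu>_def
  proof (rule has_bochner_integral_density [OF theta_measurable g_meas])
    have "g x *\<^sub>R theta (p0 t - h (p t \<otimes>\<^sub>c x))
        = (\<Sum>v\<in>?V. u v / measure lebesgue (B v) * v $ t * indicator (B v) x)" for x
      unfolding g_def real_scaleR_def sum_distrib_right
    proof (rule sum.cong [OF refl])
      fix v assume v: "v \<in> ?V"
      show "u v / measure lebesgue (B v) * indicator (B v) x * theta (p0 t - h (p t \<otimes>\<^sub>c x))
        = u v / measure lebesgue (B v) * v $ t * indicator (B v) x"
        using B(4) [OF v] by (simp add: indicator_def)
    qed
    moreover have "has_bochner_integral (lebesgue_on orthant)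
        (\<lambda>x. \<Sum>v\<in>?V. u v / measure lebesgue (B v) * v $ t * indicator (B v) x)
        (\<Sum>v\<in>?V. u v / measure lebesgue (B v) * v $ t * measure lebesgue (B v))"
    proof (intro has_bochner_integral_sum has_bochner_integral_mult_right)
      fix v assume v: "v \<in> ?V"
      have "has_bochner_integral (lebesgue_on orthant) (indicator (B v))
          (measure (lebesgue_on orthant) (B v))"
        using B(1) [OF v] fmeasurableD2 [OF B(2) [OF v]]
        by (intro has_bochner_integral_real_indicator B_sets v)
          (simp add: emeasure_restrict_space less_top del: emeasure_completion)
      then show "has_bochner_integral (lebesgue_on orthant) (indicator (B v)) (measure lebesgue (B v))"
        using B(1) [OF v] by (simp add: measure_restrict_space)
    qed
    moreover have "(\<Sum>v\<in>?V. u v / measure lebesgue (B v) * v $ t * measure lebesgue (B v)) = y $ t"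
      unfolding u(1) sum_component vector_scaleR_component
      by (rule sum.cong [OF refl]) (use B(3) in force)
    ultimately show "has_bochner_integral (lebesgue_on orthant)
        (\<lambda>x. g x *\<^sub>R theta (p0 t - h (p t \<otimes>\<^sub>c x))) (y $ t)"
      by simp
  qed (simp add: g_nonneg)
  moreover have "sets \<mu> = sets (lebesgue_on orthant)" by (simp add: \<mu>_def)
  moreover have "absolutely_continuous (lebesgue_on orthant) \<mu>"
    unfolding \<mu>_def by (intro absolutely_continuousI_density) measurable
  ultimately show ?thesis by (auto simp: condition_S_def)
qed

lemma condition_S_iff: "condition_S h p0 p y \<longleftrightarrow> y \<in> spectral_cone h p0 p"
  using condition_S_imp_spectral_cone spectral_cone_imp_condition_S by blast

end

theorem proposition5p4:
  fixes h :: "real ^ 'n::finite \<Rightarrow> real"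
    and p0 :: "'t::finite \<Rightarrow> real"
    and p :: "'t \<Rightarrow> real ^ 'n"
  assumes "unit_cost_function h"
    and "\<And>t. p0 t > 0"
    and "\<And>t i. p t $ i > 0"
  shows "(\<forall>y :: real ^ 't. (\<forall>t. y $ t \<ge> 0) \<longrightarrow> condition_N h p0 p y \<longrightarrow> condition_S h p0 p y)
    \<longleftrightarrow> discretely_convex (spectral_cone h p0 p)"
proof -
  interpret expenditure_data h p0 p using assms by unfold_locales
  let ?K = "spectral_cone h p0 p"
  have V: "finite (Z ` domains h p0 p)" "?K = convex_cone hull (Z ` domains h p0 p)"
    by (simp_all add: finite_domains spectral_cone_def)
  \<comment> \<open>The spectra themselves are the required generators, with coordinates 0 and
    1.\<close>
  then have K: "polyhedral_cone ?K" "sign_spanned ?K"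
    using spectrum_01 [of h p0 p] unfolding polyhedral_cone_def sign_spanned_def by blast+
  have "(\<forall>y :: real ^ 't. (\<forall>t. y $ t \<ge> 0) \<longrightarrow> condition_N h p0 p y \<longrightarrow> condition_S h p0 p y)
    \<longleftrightarrow> (\<forall>y. condition_N h p0 p y \<longrightarrow> y \<in> ?K)"
    using condition_N_nonneg condition_S_iff by blast
  also have "\<dots> \<longleftrightarrow> sign_spanned (dual_cone ?K)"
    by (simp add: condition_N_iff sign_spanned_dual_cone_iff [OF V])
  also have "\<dots> \<longleftrightarrow> discretely_convex ?K"
  proof
    assume "sign_spanned (dual_cone ?K)"
    then show "discretely_convex ?K"
      using K sign_spanned_normal_cone face_of_imp_subset unfolding discretely_convex_def by blast
  next
    \<comment> \<open>The empty face has the whole dual cone as its normal cone.\<close>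
    assume "discretely_convex ?K"
    then show "sign_spanned (dual_cone ?K)"
      using empty_face_of unfolding discretely_convex_def by (metis normal_cone_empty)
  qed
  finally show ?thesis .
qed

end
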